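(* For each $(\alpha,j)\in\{(x,1),(y,2),(z,3)\}$, the phase flow of the subsystem ${\rm d}{\bf Z}^{[j]}(t)=M_\alpha{\bf Z}^{[j]}(t)\,{\rm d}t+\lambda^{[j]}\,{\rm d}W(t)$, ${\bf Z}^{[j]}=(({\bf E}^{[j]})^\top,({\bf H}^{[j]})^\top)^\top$, preserves the symplectic structure $$\overline{\omega}^{[j]}(t):=\int_D d{\bf E}^{[j]}(t,{\bf x})\wedge{\rm curl}_\alpha\,d{\bf H}^{[j]}(t,{\bf x})\,{\rm d}{\bf x},$$ that is, $\overline{\omega}^{[j]}(t)=\overline{\omega}^{[j]}(0)$, $\mathbb{P}$-almost surely.
   Context: $D=(a_1^-,a_1^+)\times(a_2^-,a_2^+)\times(a_3^-,a_3^+)\subset\mathbb{R}^3$ is a cuboid (coordinates $(x,y,z)$) with boundary $\Gamma=\partial D$; $\Gamma_j^{\pm}=\{x\in\overline{D}: x_j=a_j^{\pm}\}$, $\Gamma_j=\Gamma_j^-\cup\Gamma_j^+$. $V=L^2(D)^6$. $U=\{f\in L^2(D): f=0\text{ on }\Gamma\}$ with the $L^2(D)$ inner product (as a space of $L^2$-classes this is $L^2(D)$), and $W$ is a $Q$-Wiener process on $U$, with $Q$ symmetric, positive definite and of trace class. For $v=(v_1,v_2,v_3)$ put ${\rm curl}_xv=(0,-\partial_xv_3,\partial_xv_2)$, ${\rm curl}_yv=(\partial_yv_3,0,-\partial_yv_1)$, ${\rm curl}_zv=(-\partial_zv_2,\partial_zv_1,0)$, and let $M_\alpha({\bf E},{\bf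 H})=({\rm curl}_\alpha{\bf H},-{\rm curl}_\alpha{\bf E})$ on $V$ with domains $\mathcal{D}(M_x)=\{u\in V:M_xu\in V,\ u_2=u_3=0\text{ on }\Gamma_1\}$, $\mathcal{D}(M_y)=\{u\in V:M_yu\in V,\ u_1=u_3=0\text{ on }\Gamma_2\}$, $\mathcal{D}(M_z)=\{u\in V:M_zu\in V,\ u_1=u_2=0\text{ on }\Gamma_3\}$. Each $M_\alpha$ generates a unitary $C_0$-semigroup $S_\alpha(t)=e^{tM_\alpha}$ on $V$. With $\lambda_i=(\lambda_i^1,\lambda_i^2,\lambda_i^3)^\top\in\mathbb{R}^3$ ($i=1,2$) put $\lambda^{[1]}=(\lambda_1^1,0,0,\lambda_2^1,0,0)^\top$, $\lambda^{[2]}=(0,\lambda_1^2,0,0,\lambda_2^2,0)^\top$, $\lambda^{[3]}=(0,0,\lambda_1^3,0,0,\lambda_2^3)^\top$; these act on $U$ by multiplication. The solution (phase flow) is ${\bf Z}^{[j]}(t)=S_\alpha(t){\bf Z}^{[j]}_0+\int_0^tS_\alpha(t-s)\lambda^{[j]}\,{\rm d}W(s)$. Here $d$ denotes the exterior derivative with respect to the initial value ${\bf Z}^{[j]}_0$ and $a\wedge b=\sum_{i=1}^3a_i\wedge b_i$ for vectors of one-forms. Thus $\overline{\omega}^{[j]}(t)$ is the two-form which on two initial variations $\xi_0,\eta_0\in\mathcal{D}(M_\alpha)$ takes the value $\int_D\big(\xi^E(t)\cdot{\rm curl}_\alpha\eta^H(t)-\eta^E(t)\cdot{\rm curl}_\alpha\xi^H(t)\big){\rm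 d}{\bf x}$, where $\xi(t)=(\xi^E(t),\xi^H(t))$ and $\eta(t)=(\eta^E(t),\eta^H(t))$ are the derivatives of ${\bf Z}^{[j]}(t)$ with respect to ${\bf Z}^{[j]}_0$ in the directions $\xi_0$ and $\eta_0$. *)

theory Defs
  imports "HOL-Probability.Probability"
begin

(* Elements of L^2(D) are represented by functions on all of R^3. Values outside D are irrelevant,
   and equality in L^2(D) is equality almost everywhere on D. *)

definition L2 :: "(real^3) set \<Rightarrow> (real^3 \<Rightarrow> 'b::euclidean_space) set" where
  "L2 D = {f. f \<in> borel_measurable (lebesgue_on D) \<and>
              integrable (lebesgue_on D) (\<lambda>x. (norm (f x))\<^sup>2)}"

definition L2_eq :: "(real^3) set \<Rightarrow> (real^3 \<Rightarrow> 'b::euclidean_space) \<Rightarrow> (real^3 \<Rightarrow> 'b) \<Rightarrow> bool" where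
  "L2_eq D f g \<longleftrightarrow> (AE x in lebesgue_on D. f x = g x)"

definition L2_inner :: "(real^3) set \<Rightarrow> (real^3 \<Rightarrow> 'b::euclidean_space) \<Rightarrow> (real^3 \<Rightarrow> 'b) \<Rightarrow> real" where
  "L2_inner D f g = (\<integral>x. f x \<bullet> g x \<partial>(lebesgue_on D))"

definition L2_norm :: "(real^3) set \<Rightarrow> (real^3 \<Rightarrow> 'b::euclidean_space) \<Rightarrow> real" where
  "L2_norm D f = sqrt (L2_inner D f f)"

definition L2_borel :: "(real^3) set \<Rightarrow> (real^3 \<Rightarrow> 'b::euclidean_space) measure" where
  "L2_borel D = sigma (L2 D)
     {G. G \<subseteq> L2 D \<and>
         (\<forall>f\<in>G. \<exists>e>0. \<forall>g\<in>L2 D. L2_norm D (\<lambda>x. g x - f x) < e \<longrightarrow> g \<in> G)}"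

definition L2_operator ::
    "(real^3) set \<Rightarrow> ((real^3 \<Rightarrow> 'b::euclidean_space) \<Rightarrow> (real^3 \<Rightarrow> 'c::euclidean_space)) \<Rightarrow> bool" where
  "L2_operator D T \<longleftrightarrow>
     (\<forall>f\<in>L2 D. T f \<in> L2 D) \<and>
     (\<forall>f\<in>L2 D. \<forall>g\<in>L2 D. L2_eq D (T (\<lambda>x. f x + g x)) (\<lambda>x. T f x + T g x)) \<and>
     (\<forall>c. \<forall>f\<in>L2 D. L2_eq D (T (\<lambda>x. c *\<^sub>R f x)) (\<lambda>x. c *\<^sub>R T f x)) \<and>
     (\<exists>C. \<forall>f\<in>L2 D. L2_norm D (T f) \<le> C * L2_norm D f)"

definition L2_onb :: "(real^3) set \<Rightarrow> (nat \<Rightarrow> real^3 \<Rightarrow> real) \<Rightarrow> bool" where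
  "L2_onb D e \<longleftrightarrow>
     (\<forall>n. e n \<in> L2 D) \<and>
     (\<forall>m n. L2_inner D (e m) (e n) = (if m = n then 1 else 0)) \<and>
     (\<forall>f\<in>L2 D. (\<forall>n. L2_inner D f (e n) = 0) \<longrightarrow> L2_eq D f (\<lambda>x. 0))"


definition partial :: "3 \<Rightarrow> (real^3 \<Rightarrow> real) \<Rightarrow> real^3 \<Rightarrow> real" where
  "partial i f x = deriv (\<lambda>s. f (x + s *\<^sub>R axis i 1)) 0"

primrec C_diff :: "nat \<Rightarrow> (real^3 \<Rightarrow> real) \<Rightarrow> bool" where
  "C_diff 0 f \<longleftrightarrow> continuous_on UNIV f"
| "C_diff (Suc k) f \<longleftrightarrow>
     (\<forall>i. (\<forall>x. (\<lambda>s. f (x + s *\<^sub>R axis i 1)) differentiable (at 0)) \<and> C_diff k (partial i f))"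

definition test_functions :: "(real^3) set \<Rightarrow> (real^3 \<Rightarrow> real) set" where
  "test_functions D = {\<phi>. (\<forall>k. C_diff k \<phi>) \<and> compact (closure {x. \<phi> x \<noteq> 0}) \<and>
                          closure {x. \<phi> x \<noteq> 0} \<subseteq> D}"

definition has_weak_partial ::
    "(real^3) set \<Rightarrow> 3 \<Rightarrow> (real^3 \<Rightarrow> 'b::euclidean_space) \<Rightarrow> (real^3 \<Rightarrow> 'b) \<Rightarrow> bool" where
  "has_weak_partial D i f g \<longleftrightarrow>
     (\<forall>\<phi>\<in>test_functions D.
        (\<integral>x. partial i \<phi> x *\<^sub>R f x \<partial>(lebesgue_on D)) = - (\<integral>x. \<phi> x *\<^sub>R g x \<partial>(lebesgue_on D)))"

(* The directions x, y, z are 1, 2, 3 of type 3 (where 3 = 0), and the directional curl is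
   curl_j v = d/dx_j (curl_coeff j v), the partial derivative being distributional. *)

definition curl_coeff :: "3 \<Rightarrow> real^3 \<Rightarrow> real^3" where
  "curl_coeff j v =
     (if j = 1 then vector [0, - v$3, v$2]
      else if j = 2 then vector [v$3, 0, - v$1]
      else vector [- v$2, v$1, 0])"

definition has_curl :: "(real^3) set \<Rightarrow> 3 \<Rightarrow> (real^3 \<Rightarrow> real^3) \<Rightarrow> (real^3 \<Rightarrow> real^3) \<Rightarrow> bool" where
  "has_curl D j v w \<longleftrightarrow> w \<in> L2 D \<and> has_weak_partial D j (\<lambda>x. curl_coeff j (v x)) w"

definition curl :: "(real^3) set \<Rightarrow> 3 \<Rightarrow> (real^3 \<Rightarrow> real^3) \<Rightarrow> real^3 \<Rightarrow> real^3" where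
  "curl D j v = (SOME w. has_curl D j v w)"

(* f = 0 on the two faces of the cuboid (a,b) orthogonal to direction j, in the sense of traces.
   A function whose weak derivative in direction j is in L^2 has a representative g that is
   continuous up to the faces along almost every line in direction j; its values there are the
   trace. The line meeting x is parametrised by its j-th coordinate s. *)

definition vanishes_on_faces :: "real^3 \<Rightarrow> real^3 \<Rightarrow> 3 \<Rightarrow> (real^3 \<Rightarrow> real) \<Rightarrow> bool" where
  "vanishes_on_faces a b j f \<longleftrightarrow>
     (\<exists>g. L2_eq (box a b) f g \<and>
        (AE x in lebesgue_on (box a b).
           let l = (\<lambda>s. g (\<chi> i. if i = j then s else x$i)) in
             continuous_on {a$j..b$j} l \<and> l (a$j) = 0 \<and> l (b$j) = 0))"

type_synonym em_field = "real^3 \<Rightarrow> (real^3) \<times> (real^3)"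

definition Efld :: "em_field \<Rightarrow> real^3 \<Rightarrow> real^3" where "Efld u = (\<lambda>x. fst (u x))"
definition Hfld :: "em_field \<Rightarrow> real^3 \<Rightarrow> real^3" where "Hfld u = (\<lambda>x. snd (u x))"

definition maxwell_op :: "(real^3) set \<Rightarrow> 3 \<Rightarrow> em_field \<Rightarrow> em_field" where
  "maxwell_op D j u = (\<lambda>x. (curl D j (Hfld u) x, - curl D j (Efld u) x))"

definition maxwell_dom :: "real^3 \<Rightarrow> real^3 \<Rightarrow> 3 \<Rightarrow> em_field set" where
  "maxwell_dom a b j =
     {u \<in> L2 (box a b).
        (\<exists>w. has_curl (box a b) j (Efld u) w) \<and> (\<exists>w. has_curl (box a b) j (Hfld u) w) \<and>
        (\<forall>k. k \<noteq> j \<longrightarrow> vanishes_on_faces a b j (\<lambda>x. Efld u x $ k))}"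


definition C0_semigroup :: "(real^3) set \<Rightarrow> (real \<Rightarrow> em_field \<Rightarrow> em_field) \<Rightarrow> bool" where
  "C0_semigroup D S \<longleftrightarrow>
     (\<forall>t\<ge>0. L2_operator D (S t)) \<and>
     (\<forall>u\<in>L2 D. L2_eq D (S 0 u) u) \<and>
     (\<forall>s\<ge>0. \<forall>t\<ge>0. \<forall>u\<in>L2 D. L2_eq D (S (s + t) u) (S s (S t u))) \<and>
     (\<forall>u\<in>L2 D. ((\<lambda>t. L2_norm D (\<lambda>x. S t u x - u x)) \<longlongrightarrow> 0) (at_right 0))"

definition unitary_semigroup :: "(real^3) set \<Rightarrow> (real \<Rightarrow> em_field \<Rightarrow> em_field) \<Rightarrow> bool" where
  "unitary_semigroup D S \<longleftrightarrow>
     (\<forall>t\<ge>0. (\<forall>u\<in>L2 D. L2_norm D (S t u) = L2_norm D u) \<and>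
             (\<forall>v\<in>L2 D. \<exists>u\<in>L2 D. L2_eq D (S t u) v))"

definition is_generator ::
    "(real^3) set \<Rightarrow> (real \<Rightarrow> em_field \<Rightarrow> em_field) \<Rightarrow> em_field set \<Rightarrow> (em_field \<Rightarrow> em_field) \<Rightarrow> bool" where
  "is_generator D S dm A \<longleftrightarrow>
     (\<forall>u\<in>L2 D. \<forall>v\<in>L2 D.
        ((\<lambda>h. L2_norm D (\<lambda>x. (1/h) *\<^sub>R (S h u x - u x) - v x)) \<longlongrightarrow> 0) (at_right 0)
          \<longleftrightarrow> u \<in> dm \<and> L2_eq D v (A u))"


(* The space U is L^2(D): as a set of classes, the condition f = 0 on the boundary is void.
   For a positive operator, finiteness of the trace in one orthonormal basis is the trace class
   property. *)

definition covariance_operator ::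
    "(real^3) set \<Rightarrow> ((real^3 \<Rightarrow> real) \<Rightarrow> (real^3 \<Rightarrow> real)) \<Rightarrow> bool" where
  "covariance_operator D Q \<longleftrightarrow>
     L2_operator D Q \<and>
     (\<forall>f\<in>L2 D. \<forall>g\<in>L2 D. L2_inner D (Q f) g = L2_inner D f (Q g)) \<and>
     (\<forall>f\<in>L2 D. \<not> L2_eq D f (\<lambda>x. 0) \<longrightarrow> L2_inner D (Q f) f > 0) \<and>
     (\<exists>e. L2_onb D e \<and> summable (\<lambda>n. L2_inner D (Q (e n)) (e n)))"

definition wiener_process ::
    "'w measure \<Rightarrow> (real^3) set \<Rightarrow> ((real^3 \<Rightarrow> real) \<Rightarrow> (real^3 \<Rightarrow> real)) \<Rightarrow>
     (real \<Rightarrow> 'w \<Rightarrow> real^3 \<Rightarrow> real) \<Rightarrow> bool" where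
  "wiener_process P D Q W \<longleftrightarrow>
     prob_space P \<and>
     (\<forall>t\<ge>0. W t \<in> measurable P (L2_borel D)) \<and>
     (AE \<omega> in P. L2_eq D (W 0 \<omega>) (\<lambda>x. 0)) \<and>
     (AE \<omega> in P. \<forall>t\<ge>0. ((\<lambda>s. L2_norm D (\<lambda>x. W s \<omega> x - W t \<omega> x)) \<longlongrightarrow> 0) (at t within {0..})) \<and>
     (\<forall>n (\<tau> :: nat \<Rightarrow> real). 0 \<le> \<tau> 0 \<and> mono \<tau> \<longrightarrow>
        prob_space.indep_vars P (\<lambda>_. L2_borel D)
          (\<lambda>k \<omega> x. W (\<tau> (Suc k)) \<omega> x - W (\<tau> k) \<omega> x) {..<n}) \<and>
     (\<forall>s\<ge>0. \<forall>t>s. \<forall>h\<in>L2 D. \<not> L2_eq D h (\<lambda>x. 0) \<longrightarrow>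
        distributed P lborel (\<lambda>\<omega>. L2_inner D (\<lambda>x. W t \<omega> x - W s \<omega> x) h)
          (normal_density 0 (sqrt ((t - s) * L2_inner D (Q h) h))))"

definition operator_sqrt ::
    "(real^3) set \<Rightarrow> ((real^3 \<Rightarrow> real) \<Rightarrow> (real^3 \<Rightarrow> real)) \<Rightarrow>
     ((real^3 \<Rightarrow> real) \<Rightarrow> (real^3 \<Rightarrow> real)) \<Rightarrow> bool" where
  "operator_sqrt D Q R \<longleftrightarrow>
     L2_operator D R \<and>
     (\<forall>f\<in>L2 D. \<forall>g\<in>L2 D. L2_inner D (R f) g = L2_inner D f (R g)) \<and>
     (\<forall>f\<in>L2 D. L2_inner D (R f) f \<ge> 0) \<and>
     (\<forall>f\<in>L2 D. L2_eq D (R (R f)) (Q f))"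

(* Deterministic elementary integrand sum_{k<n} 1_{(tau_k, tau_(k+1)]} A_k and its integral. *)

definition elementary ::
    "nat \<Rightarrow> (nat \<Rightarrow> real) \<Rightarrow> (nat \<Rightarrow> (real^3 \<Rightarrow> real) \<Rightarrow> em_field) \<Rightarrow> real \<Rightarrow> (real^3 \<Rightarrow> real) \<Rightarrow> em_field" where
  "elementary n \<tau> A s f = (\<lambda>x. \<Sum>k<n. indicat_real {\<tau> k<..\<tau> (Suc k)} s *\<^sub>R A k f x)"

definition elementary_integral ::
    "(real \<Rightarrow> 'w \<Rightarrow> real^3 \<Rightarrow> real) \<Rightarrow> nat \<Rightarrow> (nat \<Rightarrow> real) \<Rightarrow>
     (nat \<Rightarrow> (real^3 \<Rightarrow> real) \<Rightarrow> em_field) \<Rightarrow> 'w \<Rightarrow> em_field" where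
  "elementary_integral W n \<tau> A \<omega> =
     (\<lambda>x. \<Sum>k<n. A k (\<lambda>y. W (\<tau> (Suc k)) \<omega> y - W (\<tau> k) \<omega> y) x)"

(* I is the Ito integral over [0,t] of the deterministic operator-valued integrand Phi: the
   L^2(P;V)-limit of the integrals of elementary integrands that approximate Phi in
   L^2([0,t]; L_2(Q^(1/2) U, V)), whose norm is the Hilbert-Schmidt norm of Phi Q^(1/2). *)

definition has_ito_integral ::
    "'w measure \<Rightarrow> (real^3) set \<Rightarrow> ((real^3 \<Rightarrow> real) \<Rightarrow> (real^3 \<Rightarrow> real)) \<Rightarrow>
     (real \<Rightarrow> 'w \<Rightarrow> real^3 \<Rightarrow> real) \<Rightarrow> (real \<Rightarrow> (real^3 \<Rightarrow> real) \<Rightarrow> em_field) \<Rightarrow> real \<Rightarrow>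
     ('w \<Rightarrow> em_field) \<Rightarrow> bool" where
  "has_ito_integral P D Q W \<Phi> t I \<longleftrightarrow>
     I \<in> measurable P (L2_borel D) \<and>
     (\<forall>f\<in>L2 D. (\<lambda>s. \<Phi> s f) \<in> measurable (restrict_space borel {0..t}) (L2_borel D)) \<and>
     (\<exists>R e n \<tau> A.
        operator_sqrt D Q R \<and> L2_onb D e \<and>
        (\<forall>m :: nat. mono (\<tau> m) \<and> \<tau> m 0 = 0 \<and> \<tau> m (n m) = t \<and> (\<forall>k<n m. L2_operator D (A m k))) \<and>
        (\<lambda>m. \<integral>\<^sup>+s\<in>{0..t}. (\<Sum>k. ennreal ((L2_norm D
            (\<lambda>x. elementary (n m) (\<tau> m) (A m) s (R (e k)) x - \<Phi> s (R (e k)) x))\<^sup>2)) \<partial>lborel)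
          \<longlonglongrightarrow> 0 \<and>
        (\<lambda>m. \<integral>\<^sup>+\<omega>. ennreal ((L2_norm D
            (\<lambda>x. elementary_integral W (n m) (\<tau> m) (A m) \<omega> x - I \<omega> x))\<^sup>2) \<partial>P)
          \<longlonglongrightarrow> 0)"

(* Multiplication by lambda^[j], whose only nonzero entries are the j-th components of lambda_1
   (electric part) and lambda_2 (magnetic part). *)

definition noise_mult :: "3 \<Rightarrow> real^3 \<Rightarrow> real^3 \<Rightarrow> (real^3 \<Rightarrow> real) \<Rightarrow> em_field" where
  "noise_mult j lam1 lam2 f = (\<lambda>x. f x *\<^sub>R (axis j (lam1$j), axis j (lam2$j)))"

definition stochastic_convolution ::
    "'w measure \<Rightarrow> (real^3) set \<Rightarrow> ((real^3 \<Rightarrow> real) \<Rightarrow> (real^3 \<Rightarrow> real)) \<Rightarrow>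
     (real \<Rightarrow> 'w \<Rightarrow> real^3 \<Rightarrow> real) \<Rightarrow> (real \<Rightarrow> em_field \<Rightarrow> em_field) \<Rightarrow> ((real^3 \<Rightarrow> real) \<Rightarrow> em_field) \<Rightarrow>
     (real \<Rightarrow> 'w \<Rightarrow> em_field) \<Rightarrow> bool" where
  "stochastic_convolution P D Q W S B Y \<longleftrightarrow>
     (\<forall>t\<ge>0. has_ito_integral P D Q W (\<lambda>s f. S (t - s) (B f)) t (Y t))"

definition phase_flow ::
    "(real \<Rightarrow> em_field \<Rightarrow> em_field) \<Rightarrow> (real \<Rightarrow> 'w \<Rightarrow> em_field) \<Rightarrow> real \<Rightarrow> 'w \<Rightarrow> em_field \<Rightarrow> em_field" where
  "phase_flow S Y t \<omega> z = (\<lambda>x. S t z x + Y t \<omega> x)"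


definition has_dir_deriv ::
    "(real^3) set \<Rightarrow> (em_field \<Rightarrow> em_field) \<Rightarrow> em_field \<Rightarrow> em_field \<Rightarrow> em_field \<Rightarrow> bool" where
  "has_dir_deriv D F z \<zeta> \<xi> \<longleftrightarrow>
     \<xi> \<in> L2 D \<and>
     ((\<lambda>\<epsilon>. L2_norm D (\<lambda>x. (1/\<epsilon>) *\<^sub>R (F (\<lambda>y. z y + \<epsilon> *\<^sub>R \<zeta> y) x - F z x) - \<xi> x)) \<longlongrightarrow> 0) (at 0)"

definition dir_deriv :: "(real^3) set \<Rightarrow> (em_field \<Rightarrow> em_field) \<Rightarrow> em_field \<Rightarrow> em_field \<Rightarrow> em_field" where
  "dir_deriv D F z \<zeta> = (SOME \<xi>. has_dir_deriv D F z \<zeta> \<xi>)"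

definition wedge :: "('v \<Rightarrow> real^3) \<Rightarrow> ('v \<Rightarrow> real^3) \<Rightarrow> 'v \<Rightarrow> 'v \<Rightarrow> real" where
  "wedge \<alpha> \<beta> \<xi> \<eta> = (\<Sum>i\<in>UNIV. \<alpha> \<xi> $ i * \<beta> \<eta> $ i - \<alpha> \<eta> $ i * \<beta> \<xi> $ i)"

(* The two-form int_D dE wedge curl_j dH at the initial value z, where F maps z to the solution
   (E, H) at a given time and d is the derivative with respect to z. *)

definition symplectic_form ::
    "(real^3) set \<Rightarrow> 3 \<Rightarrow> (em_field \<Rightarrow> em_field) \<Rightarrow> em_field \<Rightarrow> em_field \<Rightarrow> em_field \<Rightarrow> real" where
  "symplectic_form D j F z \<xi>0 \<eta>0 =
     (\<integral>x. wedge (\<lambda>\<zeta>. Efld (dir_deriv D F z \<zeta>) x) (\<lambda>\<zeta>. curl D j (Hfld (dir_deriv D F z \<zeta>)) x) \<xi>0 \<eta>0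
        \<partial>(lebesgue_on D))"

end

theory Submission
  imports Defs
begin

text \<open>
  The flow is affine in the initial value, with linear part \<open>S t\<close>, so the variations evolve by the
  isometric semigroup and the noise plays no role. On the domain of \<open>M = maxwell_op D j\<close> the
  directional curl is symmetric, \<open>\<langle>\<eta>\<^sup>E, curl \<xi>\<^sup>H\<rangle> = \<langle>curl \<eta>\<^sup>E, \<xi>\<^sup>H\<rangle>\<close>, so the two-form equals \<open>\<langle>\<xi>, M \<eta>\<rangle>\<close>, and
  \<open>\<langle>S t \<xi>, M (S t \<eta>)\<rangle> = \<langle>S t \<xi>, S t (M \<eta>)\<rangle> = \<langle>\<xi>, M \<eta>\<rangle>\<close>. The symmetry of the curl needs no
  integration by parts: the generator of an isometric semigroup is skew-symmetric, and the domain
  of \<open>M\<close> contains the electric and the magnetic part of each of its elements.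
\<close>

section \<open>Inner product and norm on square integrable functions\<close>

lemma L2_measurable: "f \<in> L2 D \<Longrightarrow> f \<in> borel_measurable (lebesgue_on D)"
  by (simp add: L2_def)

lemma L2_integrable_inner:
  assumes f: "f \<in> L2 D" and g: "g \<in> L2 D"
  shows "integrable (lebesgue_on D) (\<lambda>x. f x \<bullet> g x)"
proof (rule Bochner_Integration.integrable_bound)
  show "integrable (lebesgue_on D) (\<lambda>x. (norm (f x))\<^sup>2 + (norm (g x))\<^sup>2)"
    using assms by (auto simp: L2_def)
  show "(\<lambda>x. f x \<bullet> g x) \<in> borel_measurable (lebesgue_on D)"
    using L2_measurable[OF f] L2_measurable[OF g] by measurable
  show "AE x in lebesgue_on D. norm (f x \<bullet> g x) \<le> norm ((norm (f x))\<^sup>2 + (norm (g x))\<^sup>2)"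
  proof (rule AE_I2)
    fix x
    have "\<bar>f x \<bullet> g x\<bar> \<le> norm (f x) * norm (g x)" by (rule Cauchy_Schwarz_ineq2)
    also have "\<dots> \<le> (norm (f x))\<^sup>2 + (norm (g x))\<^sup>2"
      using sum_squares_bound[of "norm (f x)" "norm (g x)"]
        mult_nonneg_nonneg[of "norm (f x)" "norm (g x)", OF norm_ge_zero norm_ge_zero] by linarith
    finally show "norm (f x \<bullet> g x) \<le> norm ((norm (f x))\<^sup>2 + (norm (g x))\<^sup>2)" by simp
  qed
qed

text \<open>Expanding the squared norm of the sum leaves only inner products, each integrable by
  \<open>L2_integrable_inner\<close>.\<close>

lemma L2_add:
  assumes f: "f \<in> L2 D" and g: "g \<in> L2 D"
  shows "(\<lambda>x. f x + g x) \<in> L2 D"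
proof -
  have "integrable (lebesgue_on D) (\<lambda>x. f x \<bullet> f x + 2 * (f x \<bullet> g x) + g x \<bullet> g x)"
    by (intro Bochner_Integration.integrable_add integrable_mult_right L2_integrable_inner f g)
  then show ?thesis
    using L2_measurable[OF f] L2_measurable[OF g]
    by (simp add: L2_def power2_norm_eq_inner inner_simps inner_commute algebra_simps)
qed

lemma L2_scaleR: "f \<in> L2 D \<Longrightarrow> (\<lambda>x. c *\<^sub>R f x) \<in> L2 D"
  by (auto simp: L2_def power_mult_distrib)

lemma L2_diff:
  assumes "f \<in> L2 D" and "g \<in> L2 D"
  shows "(\<lambda>x. f x - g x) \<in> L2 D"
  using L2_add[OF assms(1) L2_scaleR[OF assms(2), of "-1"]] by simp

lemma L2_zero: "(\<lambda>x. 0) \<in> L2 D"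
  by (simp add: L2_def)

lemma L2_inner_diff_left:
  "\<lbrakk>f \<in> L2 D; g \<in> L2 D; h \<in> L2 D\<rbrakk> \<Longrightarrow> L2_inner D (\<lambda>x. f x - g x) h = L2_inner D f h - L2_inner D g h"
  by (simp add: L2_inner_def inner_diff_left L2_integrable_inner)

lemma L2_inner_commute: "L2_inner D f g = L2_inner D g f"
  by (simp add: L2_inner_def inner_commute)

lemma L2_inner_diff_right:
  "\<lbrakk>f \<in> L2 D; g \<in> L2 D; h \<in> L2 D\<rbrakk> \<Longrightarrow> L2_inner D h (\<lambda>x. f x - g x) = L2_inner D h f - L2_inner D h g"
  by (simp add: L2_inner_def inner_diff_right L2_integrable_inner)

lemma L2_inner_scaleR_left: "L2_inner D (\<lambda>x. c *\<^sub>R f x) g = c * L2_inner D f g"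
  by (simp add: L2_inner_def)

lemma L2_inner_scaleR_right: "L2_inner D f (\<lambda>x. c *\<^sub>R g x) = c * L2_inner D f g"
  by (simp add: L2_inner_def)

lemma L2_inner_self_nonneg: "0 \<le> L2_inner D f f"
  by (simp add: L2_inner_def)

lemma L2_norm_square: "(L2_norm D f)\<^sup>2 = L2_inner D f f"
  by (simp add: L2_norm_def L2_inner_self_nonneg)

lemma L2_norm_nonneg: "0 \<le> L2_norm D f"
  by (simp add: L2_norm_def L2_inner_self_nonneg)

text \<open>The quadratic s -> ||f - s g||^2 is nonnegative. As elements are functions rather than
  classes, the inner product is only semidefinite, and a vanishing leading coefficient is a case of
  its own.\<close>

lemma L2_Cauchy_Schwarz:
  assumes f: "f \<in> L2 D" and g: "g \<in> L2 D"
  shows "\<bar>L2_inner D f g\<bar> \<le> L2_norm D f * L2_norm D g"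
proof -
  let ?A = "L2_inner D f f" and ?B = "L2_inner D g g" and ?C = "L2_inner D f g"
  have pos: "0 \<le> ?A - 2 * s * ?C + s\<^sup>2 * ?B" for s
  proof -
    have "0 \<le> L2_inner D (\<lambda>x. f x - s *\<^sub>R g x) (\<lambda>x. f x - s *\<^sub>R g x)"
      by (rule L2_inner_self_nonneg)
    also have "\<dots> = ?A - 2 * s * ?C + s\<^sup>2 * ?B"
      by (simp add: L2_inner_diff_left L2_inner_diff_right L2_inner_scaleR_left
          L2_inner_scaleR_right L2_diff L2_scaleR f g L2_inner_commute[of D g f]
          power2_eq_square algebra_simps)
    finally show ?thesis .
  qed
  have "?C\<^sup>2 \<le> ?A * ?B"
  proof (cases "?B = 0")
    case True
    have "?C = 0"
    proof (rule ccontr)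
      assume "?C \<noteq> 0"
      \<comment> \<open>With \<open>?B = 0\<close> the quadratic is affine in s, and this s gives it
        the value -1.\<close>
      then show False using pos[of "(?A + 1) / (2 * ?C)"] True by simp
    qed
    then show ?thesis using True by simp
  next
    case False
    then have "?B > 0" using L2_inner_self_nonneg[of D g] by simp
    \<comment> \<open>The minimiser of the quadratic, where its value is
      \<open>?A - ?C\<^sup>2 / ?B\<close>.\<close>
    then show ?thesis using pos[of "?C / ?B"]
      by (simp add: field_simps power2_eq_square)
  qed
  also have "\<dots> = (L2_norm D f * L2_norm D g)\<^sup>2"
    by (simp add: power_mult_distrib L2_norm_square)
  finally show ?thesis
    by (metis abs_le_square_iff abs_of_nonneg L2_norm_nonneg mult_nonneg_nonneg)
qed

lemma L2_eq_refl: "L2_eq D f f"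
  by (simp add: L2_eq_def)

lemma L2_eq_sym: "L2_eq D f g \<Longrightarrow> L2_eq D g f"
  by (auto simp: L2_eq_def)

lemma L2_eq_trans: "\<lbrakk>L2_eq D f g; L2_eq D g h\<rbrakk> \<Longrightarrow> L2_eq D f h"
  unfolding L2_eq_def by (elim eventually_elim2) auto

lemma L2_eq_diff: "\<lbrakk>L2_eq D f f'; L2_eq D g g'\<rbrakk> \<Longrightarrow> L2_eq D (\<lambda>x. f x - g x) (\<lambda>x. f' x - g' x)"
  unfolding L2_eq_def by (elim eventually_elim2) auto

lemma L2_eq_scaleR: "L2_eq D f f' \<Longrightarrow> L2_eq D (\<lambda>x. c *\<^sub>R f x) (\<lambda>x. c *\<^sub>R f' x)"
  unfolding L2_eq_def by (elim eventually_mono) auto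

lemma L2_inner_cong:
  assumes "f \<in> L2 D" "f' \<in> L2 D" "g \<in> L2 D" "g' \<in> L2 D" and e: "L2_eq D f f'" "L2_eq D g g'"
  shows "L2_inner D f g = L2_inner D f' g'"
  unfolding L2_inner_def
proof (rule integral_cong_AE)
  show "AE x in lebesgue_on D. f x \<bullet> g x = f' x \<bullet> g' x"
    using e unfolding L2_eq_def by (elim eventually_elim2) auto
qed (use assms in \<open>auto intro!: borel_measurable_integrable L2_integrable_inner\<close>)

lemma L2_norm_cong: "\<lbrakk>f \<in> L2 D; g \<in> L2 D; L2_eq D f g\<rbrakk> \<Longrightarrow> L2_norm D f = L2_norm D g"
  unfolding L2_norm_def by (subst L2_inner_cong[of f D g f g]) auto

text \<open>A nonnegative integrable function has integral zero exactly when it vanishes almost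
  everywhere. This later identifies the derivative of the flow from a limit of constants.\<close>

lemma L2_norm_diff_eq_0_iff:
  assumes "f \<in> L2 D" and "g \<in> L2 D"
  shows "L2_norm D (\<lambda>x. f x - g x) = 0 \<longleftrightarrow> L2_eq D f g"
proof -
  have "L2_norm D (\<lambda>x. f x - g x) = 0
      \<longleftrightarrow> (\<integral>x. (f x - g x) \<bullet> (f x - g x) \<partial>lebesgue_on D) = 0"
    by (simp add: L2_norm_def L2_inner_def)
  also have "\<dots> \<longleftrightarrow> (AE x in lebesgue_on D. (f x - g x) \<bullet> (f x - g x) = 0)"
    by (intro integral_nonneg_eq_0_iff_AE L2_integrable_inner L2_diff assms) auto
  finally show ?thesis by (simp add: L2_eq_def)
qed

text \<open>Cauchy-Schwarz bounds the error by the norm of \<open>F h - f\<close> times that of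
  \<open>g\<close>. Membership is asked for positive h only, because difference quotients of a
  semigroup are formed there.\<close>

lemma L2_inner_tendsto_left:
  assumes F: "\<And>h. h > 0 \<Longrightarrow> F h \<in> L2 D" and f: "f \<in> L2 D" and g: "g \<in> L2 D"
    and lim: "((\<lambda>h. L2_norm D (\<lambda>x. F h x - f x)) \<longlongrightarrow> 0) (at_right 0)"
  shows "((\<lambda>h::real. L2_inner D (F h) g) \<longlongrightarrow> L2_inner D f g) (at_right 0)"
proof -
  have "((\<lambda>h. L2_norm D (\<lambda>x. F h x - f x) * L2_norm D g) \<longlongrightarrow> 0) (at_right 0)"
    using tendsto_mult_right[OF lim, of "L2_norm D g"] by (simp add: mult.commute)
  then have "((\<lambda>h. L2_inner D (F h) g - L2_inner D f g) \<longlongrightarrow> 0) (at_right 0)"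
  proof (rule Lim_null_comparison[rotated])
    show "\<forall>\<^sub>F h in at_right 0. norm (L2_inner D (F h) g - L2_inner D f g)
        \<le> L2_norm D (\<lambda>x. F h x - f x) * L2_norm D g"
      using eventually_at_right_less[of 0]
    proof eventually_elim
      case (elim h)
      show ?case
        using L2_Cauchy_Schwarz[OF L2_diff[OF F[OF elim] f] g]
        by (simp add: L2_inner_diff_left F elim f g)
    qed
  qed
  then show ?thesis by (rule LIM_zero_cancel)
qed

section \<open>Bounded operators and isometries\<close>

context
  fixes D :: "(real^3) set" and T :: "(real^3 \<Rightarrow> 'b::euclidean_space) \<Rightarrow> (real^3 \<Rightarrow> 'b)"
  assumes T: "L2_operator D T"
begin

lemma L2_operator_closed: "f \<in> L2 D \<Longrightarrow> T f \<in> L2 D"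
  using T by (auto simp: L2_operator_def)

lemma L2_operator_scaleR: "f \<in> L2 D \<Longrightarrow> L2_eq D (T (\<lambda>x. c *\<^sub>R f x)) (\<lambda>x. c *\<^sub>R T f x)"
  using T by (auto simp: L2_operator_def)

lemma L2_operator_add_scaleR:
  assumes f: "f \<in> L2 D" and g: "g \<in> L2 D"
  shows "L2_eq D (T (\<lambda>x. f x + c *\<^sub>R g x)) (\<lambda>x. T f x + c *\<^sub>R T g x)"
proof -
  have "L2_eq D (T (\<lambda>x. f x + c *\<^sub>R g x)) (\<lambda>x. T f x + T (\<lambda>x. c *\<^sub>R g x) x)"
    using T f L2_scaleR[OF g, of c] by (auto simp: L2_operator_def)
  with L2_operator_scaleR[OF g, of c] show ?thesis
    unfolding L2_eq_def by (elim eventually_elim2) auto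
qed

lemma L2_operator_diff:
  assumes "f \<in> L2 D" and "g \<in> L2 D"
  shows "L2_eq D (T (\<lambda>x. f x - g x)) (\<lambda>x. T f x - T g x)"
  using L2_operator_add_scaleR[OF assms, of "-1"] by simp

text \<open>Polarisation: the inner product is determined by the norms of \<open>f\<close>,
  \<open>g\<close> and \<open>f - g\<close>. Since \<open>T\<close> is linear only up to null sets,
  the difference passes through \<open>L2_inner_cong\<close>.\<close>

lemma L2_isometry_inner:
  assumes iso: "\<And>u. u \<in> L2 D \<Longrightarrow> L2_norm D (T u) = L2_norm D u"
    and f: "f \<in> L2 D" and g: "g \<in> L2 D"
  shows "L2_inner D (T f) (T g) = L2_inner D f g"
proof -
  have polar: "L2_inner D (\<lambda>x. f x - g x) (\<lambda>x. f x - g x)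
      = L2_inner D f f - 2 * L2_inner D f g + L2_inner D g g"
    if "f \<in> L2 D" "g \<in> L2 D" for f g :: "real^3 \<Rightarrow> 'b"
    using that
    by (simp add: L2_inner_diff_left L2_inner_diff_right L2_diff L2_inner_commute[of D g f])
  have iso2: "L2_inner D (T u) (T u) = L2_inner D u u" if "u \<in> L2 D" for u
    using iso[OF that] by (metis L2_norm_square)
  have "L2_inner D (\<lambda>x. T f x - T g x) (\<lambda>x. T f x - T g x)
      = L2_inner D (T (\<lambda>x. f x - g x)) (T (\<lambda>x. f x - g x))"
    by (intro L2_inner_cong L2_diff L2_operator_closed f g L2_eq_sym[OF L2_operator_diff[OF f g]])
  also have "\<dots> = L2_inner D (\<lambda>x. f x - g x) (\<lambda>x. f x - g x)"
    by (rule iso2) (intro L2_diff f g)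
  finally show ?thesis
    using polar[OF f g] polar[of "T f" "T g"] iso2 f g L2_operator_closed by simp
qed

end

section \<open>Generators of isometric semigroups\<close>

lemma generator_quotient_tendsto:
  assumes "is_generator D S dm A" and "u \<in> dm" and "u \<in> L2 D" and "A u \<in> L2 D"
  shows "((\<lambda>h. L2_norm D (\<lambda>x. (1/h) *\<^sub>R (S h u x - u x) - A u x)) \<longlongrightarrow> 0) (at_right 0)"
  using assms by (auto simp: is_generator_def L2_eq_refl)

text \<open>The quotient of \<open>S t u\<close> minus \<open>S t (A u)\<close> is
  \<open>S t\<close> applied to the quotient of \<open>u\<close> minus \<open>A u\<close>, and the
  isometry gives both the same norm. The resulting limit, read through the equivalence in
  \<open>is_generator\<close>, yields domain membership and commutation together.\<close>

lemma generator_commute: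
  assumes C0: "C0_semigroup D S" and iso: "unitary_semigroup D S" and gen: "is_generator D S dm A"
    and u: "u \<in> dm" "u \<in> L2 D" "A u \<in> L2 D" and t: "t \<ge> 0"
  shows "S t u \<in> dm" and "L2_eq D (S t (A u)) (A (S t u))"
proof -
  have op: "L2_operator D (S s)" if "s \<ge> 0" for s using C0 that by (auto simp: C0_semigroup_def)
  note cl = L2_operator_closed[OF op]
  have quot: "L2_norm D (\<lambda>x. (1/h) *\<^sub>R (S h (S t u) x - S t u x) - S t (A u) x)
      = L2_norm D (\<lambda>x. (1/h) *\<^sub>R (S h u x - u x) - A u x)" if "h > 0" for h
  proof -
    have h: "h \<ge> 0" using that by simp
    have sg: "L2_eq D (S (p + q) u) (S p (S q u))" if "p \<ge> 0" "q \<ge> 0" for p q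
      using C0 that u by (auto simp: C0_semigroup_def)
    \<comment> \<open>Both sides equal \<open>S (h + t) u\<close> almost everywhere.\<close>
    have "L2_eq D (S h (S t u)) (S t (S h u))"
      using L2_eq_trans[OF L2_eq_sym[OF sg[OF h t]]] sg[OF t h] by (simp add: add.commute)
    \<comment> \<open>Linearity holds only up to null sets, so \<open>S t\<close> is pulled out one
      operation at a time: difference, scaling, difference.\<close>
    then have "L2_eq D (\<lambda>x. S h (S t u) x - S t u x) (S t (\<lambda>x. S h u x - u x))"
      by (rule L2_eq_trans[OF L2_eq_diff[OF _ L2_eq_refl]
            L2_eq_sym[OF L2_operator_diff[OF op[OF t] cl[OF h u(2)] u(2)]]])
    then have "L2_eq D (\<lambda>x. (1/h) *\<^sub>R (S h (S t u) x - S t u x))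
        (S t (\<lambda>x. (1/h) *\<^sub>R (S h u x - u x)))"
      by (rule L2_eq_trans[OF L2_eq_scaleR
            L2_eq_sym[OF L2_operator_scaleR[OF op[OF t] L2_diff[OF cl[OF h u(2)] u(2)]]]])
    then have "L2_eq D (\<lambda>x. (1/h) *\<^sub>R (S h (S t u) x - S t u x) - S t (A u) x)
        (S t (\<lambda>x. (1/h) *\<^sub>R (S h u x - u x) - A u x))"
      by (rule L2_eq_trans[OF L2_eq_diff[OF _ L2_eq_refl] L2_eq_sym[OF L2_operator_diff[OF op[OF t]
              L2_scaleR[OF L2_diff[OF cl[OF h u(2)] u(2)]] u(3)]]])
    then have "L2_norm D (\<lambda>x. (1/h) *\<^sub>R (S h (S t u) x - S t u x) - S t (A u) x)
        = L2_norm D (S t (\<lambda>x. (1/h) *\<^sub>R (S h u x - u x) - A u x))"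
      by (intro L2_norm_cong) (auto intro!: L2_diff L2_scaleR cl u h t)
    also have "\<dots> = L2_norm D (\<lambda>x. (1/h) *\<^sub>R (S h u x - u x) - A u x)"
      using iso t h by (auto simp: unitary_semigroup_def intro!: L2_diff L2_scaleR cl u)
    finally show ?thesis .
  qed
  have "((\<lambda>h. L2_norm D (\<lambda>x. (1/h) *\<^sub>R (S h (S t u) x - S t u x) - S t (A u) x)) \<longlongrightarrow> 0)
      (at_right 0)"
    using generator_quotient_tendsto[OF gen u]
  proof (rule Lim_transform_eventually)
    show "\<forall>\<^sub>F h in at_right 0. L2_norm D (\<lambda>x. (1/h) *\<^sub>R (S h u x - u x) - A u x)
        = L2_norm D (\<lambda>x. (1/h) *\<^sub>R (S h (S t u) x - S t u x) - S t (A u) x)"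
      using eventually_at_right_less[of 0] by eventually_elim (simp only: quot)
  qed
  then have "S t u \<in> dm \<and> L2_eq D (S t (A u)) (A (S t u))"
    using gen cl[OF t] u by (auto simp: is_generator_def)
  then show "S t u \<in> dm" and "L2_eq D (S t (A u)) (A (S t u))" by auto
qed

text \<open>This is the derivative at 0 of the constant \<open>L2_inner D (S h u) (S h v)\<close>.
  With q the difference quotient, the isometry gives <S h u, q v h> = - <q u h, v> for h > 0; the
  two sides tend to <u, A v> and - <A u, v>.\<close>

lemma generator_skew_symmetric:
  assumes C0: "C0_semigroup D S" and iso: "unitary_semigroup D S" and gen: "is_generator D S dm A"
    and u: "u \<in> dm" "u \<in> L2 D" "A u \<in> L2 D" and v: "v \<in> dm" "v \<in> L2 D" "A v \<in> L2 D"
  shows "L2_inner D u (A v) = - L2_inner D (A u) v"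
proof -
  have op: "L2_operator D (S s)" if "s \<ge> 0" for s using C0 that by (auto simp: C0_semigroup_def)
  note cl = L2_operator_closed[OF op]
  have nrm: "L2_norm D (S h w) = L2_norm D w" if "h \<ge> 0" "w \<in> L2 D" for h w
    using iso that by (auto simp: unitary_semigroup_def)
  define q where "q w h x = (1/h) *\<^sub>R (S h w x - w x)" for w h x
  have q: "q w h \<in> L2 D" if "h > 0" "w \<in> L2 D" for w h
    unfolding q_def using that by (intro L2_scaleR L2_diff cl) auto
  have lim: "((\<lambda>h. L2_norm D (\<lambda>x. q w h x - A w x)) \<longlongrightarrow> 0) (at_right 0)"
    if "w \<in> dm" "w \<in> L2 D" "A w \<in> L2 D" for w
    using generator_quotient_tendsto[OF gen that] by (simp add: q_def)
  have lu: "((\<lambda>h. L2_inner D (q u h) v) \<longlongrightarrow> L2_inner D (A u) v) (at_right 0)"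
    by (intro L2_inner_tendsto_left lim q u v)
  have "((\<lambda>h. L2_inner D (S h u) (A v)) \<longlongrightarrow> L2_inner D u (A v)) (at_right 0)"
    using C0 by (intro L2_inner_tendsto_left cl u v) (auto simp: C0_semigroup_def u)
  \<comment> \<open>Both factors vary with h, but the norm of \<open>S h u\<close> stays equal to
    that of \<open>u\<close>, so the error vanishes with its second factor.\<close>
  moreover have "((\<lambda>h. L2_inner D (S h u) (\<lambda>x. q v h x - A v x)) \<longlongrightarrow> 0) (at_right 0)"
  proof (rule Lim_null_comparison)
    show "((\<lambda>h. L2_norm D u * L2_norm D (\<lambda>x. q v h x - A v x)) \<longlongrightarrow> 0) (at_right 0)"
      using tendsto_mult_right_zero[OF lim[OF v]] .
    show "\<forall>\<^sub>F h in at_right 0. norm (L2_inner D (S h u) (\<lambda>x. q v h x - A v x))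
        \<le> L2_norm D u * L2_norm D (\<lambda>x. q v h x - A v x)"
      using eventually_at_right_less[of 0]
    proof eventually_elim
      case (elim h)
      then show ?case
        using L2_Cauchy_Schwarz[OF cl L2_diff[OF q v(3)], of h u h v] nrm[of h u] u v by simp
    qed
  qed
  ultimately have "((\<lambda>h. L2_inner D (S h u) (A v) + L2_inner D (S h u) (\<lambda>x. q v h x - A v x))
      \<longlongrightarrow> L2_inner D u (A v) + 0) (at_right 0)"
    by (rule tendsto_add)
  then have "((\<lambda>h. - L2_inner D (q u h) v) \<longlongrightarrow> L2_inner D u (A v) + 0) (at_right 0)"
  proof (rule Lim_transform_eventually)
    show "\<forall>\<^sub>F h in at_right 0. L2_inner D (S h u) (A v)
        + L2_inner D (S h u) (\<lambda>x. q v h x - A v x) = - L2_inner D (q u h) v"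
      using eventually_at_right_less[of 0]
    proof eventually_elim
      case (elim h)
      then have h: "h \<ge> 0" by simp
      have *: "L2_inner D (S h u) (S h v) = L2_inner D u v"
        by (rule L2_isometry_inner[OF op[OF h] nrm[OF h] u(2) v(2)])
      have "L2_inner D (S h u) (A v) + L2_inner D (S h u) (\<lambda>x. q v h x - A v x)
          = L2_inner D (S h u) (q v h)"
        by (simp add: L2_inner_diff_right q cl elim h u v)
      also have "\<dots> = - L2_inner D (q u h) v"
        unfolding q_def
        by (simp add: L2_inner_scaleR_left L2_inner_scaleR_right L2_inner_diff_left
            L2_inner_diff_right cl h u v * right_diff_distrib)
      finally show ?case .
    qed
  qed
  then show ?thesis
    using tendsto_unique[OF trivial_limit_at_right_real _ tendsto_minus[OF lu]] by fastforce
qed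

section \<open>The directional curl and almost everywhere equality\<close>

lemma continuous_on_curl_coeff: "continuous_on UNIV (curl_coeff j)"
proof (rule linear_continuous_on)
  have "linear (curl_coeff j)"
    by (rule linearI) (simp_all add: curl_coeff_def vec_eq_iff forall_3)
  then show "bounded_linear (curl_coeff j)" by (rule linear_conv_bounded_linear[THEN iffD1])
qed

text \<open>The field enters the weak derivative only under an integral against a test function.
  Equality of the predicates as functions lets it be rewritten under \<open>SOME\<close> in
  \<open>curl\<close>.\<close>

lemma has_curl_cong:
  assumes eq: "L2_eq D v v'" and v: "v \<in> L2 D" "v' \<in> L2 D"
  shows "has_curl D j v = has_curl D j v'"
proof -
  have "(\<integral>x. partial j \<phi> x *\<^sub>R curl_coeff j (v x) \<partial>lebesgue_on D)
      = (\<integral>x. partial j \<phi> x *\<^sub>R curl_coeff j (v' x) \<partial>lebesgue_on D)"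
    if "\<phi> \<in> test_functions D" for \<phi>
  proof (rule integral_cong_AE)
    \<comment> \<open>Order one suffices: its unfolding contains the continuity of every first
      partial derivative, hence the measurability needed here.\<close>
    have "C_diff (Suc 0) \<phi>" using that unfolding test_functions_def by blast
    then have "continuous_on UNIV (partial j \<phi>)" by simp
    then have "partial j \<phi> \<in> borel_measurable (lebesgue_on D)"
      by (intro measurable_restrict_space1 measurable_completion) (simp add: borel_measurable_continuous_onI)
    then show "(\<lambda>x. partial j \<phi> x *\<^sub>R curl_coeff j (v x)) \<in> borel_measurable (lebesgue_on D)"
      and "(\<lambda>x. partial j \<phi> x *\<^sub>R curl_coeff j (v' x)) \<in> borel_measurable (lebesgue_on D)"
      using borel_measurable_continuous_on[OF continuous_on_curl_coeff L2_measurable[OF v(1)]]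
        borel_measurable_continuous_on[OF continuous_on_curl_coeff L2_measurable[OF v(2)]]
      by (auto intro: borel_measurable_scaleR)
    show "AE x in lebesgue_on D.
        partial j \<phi> x *\<^sub>R curl_coeff j (v x) = partial j \<phi> x *\<^sub>R curl_coeff j (v' x)"
      using eq unfolding L2_eq_def by (auto elim!: eventually_mono)
  qed
  then show ?thesis by (simp add: fun_eq_iff has_curl_def has_weak_partial_def)
qed

text \<open>
  Equality everywhere, not just almost everywhere: both sides are the choice of \<open>SOME\<close> from the same
  set. Hence the uniqueness of weak derivatives is not needed.
\<close>

lemma curl_cong:
  assumes "L2_eq D v v'" and "v \<in> L2 D" "v' \<in> L2 D"
  shows "curl D j v = curl D j v'"
  using has_curl_cong[OF assms] by (simp add: curl_def)

section \<open>Electric and magnetic components\<close>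

lemma L2_fields:
  assumes "u \<in> L2 D"
  shows "Efld u \<in> L2 D" and "Hfld u \<in> L2 D"
proof -
  have m: "u \<in> borel_measurable (lebesgue_on D)" using assms by (rule L2_measurable)
  have n: "(norm (u x))\<^sup>2 = (norm (fst (u x)))\<^sup>2 + (norm (snd (u x)))\<^sup>2" for x
    by (simp add: norm_prod_def)
  have int: "integrable (lebesgue_on D) (\<lambda>x. (norm (u x))\<^sup>2)" using assms by (simp add: L2_def)
  have 1: "(\<lambda>x. fst (u x)) \<in> borel_measurable (lebesgue_on D)"
    and 2: "(\<lambda>x. snd (u x)) \<in> borel_measurable (lebesgue_on D)"
    by (rule borel_measurable_continuous_on[OF _ m], intro continuous_intros)+
  show "Efld u \<in> L2 D"
    unfolding L2_def Efld_def using 1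
    by (auto intro!: Bochner_Integration.integrable_bound[OF int] simp: n)
  show "Hfld u \<in> L2 D"
    unfolding L2_def Hfld_def using 2
    by (auto intro!: Bochner_Integration.integrable_bound[OF int] simp: n)
qed

lemma L2_Pair:
  assumes f: "f \<in> L2 D" and g: "g \<in> L2 D"
  shows "(\<lambda>x. (f x, g x)) \<in> L2 D"
proof -
  have "(\<lambda>x. (f x, g x)) \<in> borel_measurable (lebesgue_on D)"
    using L2_measurable[OF f] L2_measurable[OF g] by (rule borel_measurable_Pair)
  with assms show ?thesis by (simp add: L2_def norm_prod_def)
qed

lemma L2_inner_em_field:
  assumes "u \<in> L2 D" and "v \<in> L2 D"
  shows "L2_inner D u v = L2_inner D (Efld u) (Efld v) + L2_inner D (Hfld u) (Hfld v)"
proof -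
  have "L2_inner D u v = (\<integral>x. Efld u x \<bullet> Efld v x + Hfld u x \<bullet> Hfld v x \<partial>lebesgue_on D)"
    by (simp add: L2_inner_def Efld_def Hfld_def inner_prod_def)
  then show ?thesis
    by (simp add: L2_inner_def L2_integrable_inner L2_fields assms)
qed

lemma L2_eq_fields:
  assumes "L2_eq D u v"
  shows "L2_eq D (Efld u) (Efld v)" and "L2_eq D (Hfld u) (Hfld v)"
  using assms by (auto simp: L2_eq_def Efld_def Hfld_def elim!: eventually_mono)

section \<open>The Maxwell domain and the symmetry of the curl\<close>

text \<open>Square integrability is part of \<open>has_curl\<close>, so it holds for whichever
  function \<open>SOME\<close> selects.\<close>

lemma curl_in_L2: "\<exists>w. has_curl D j v w \<Longrightarrow> curl D j v \<in> L2 D"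
  unfolding curl_def by (drule someI_ex) (simp only: has_curl_def[of D j v "Eps _"])

lemma maxwell_domD:
  assumes "u \<in> maxwell_dom a b j"
  shows "u \<in> L2 (box a b)" and "curl (box a b) j (Efld u) \<in> L2 (box a b)"
    and "curl (box a b) j (Hfld u) \<in> L2 (box a b)"
  using assms by (auto simp: maxwell_dom_def intro: curl_in_L2)

lemma maxwell_op_fields:
  "Efld (maxwell_op D j u) = curl D j (Hfld u)"
  "Hfld (maxwell_op D j u) = (\<lambda>x. - curl D j (Efld u) x)"
  by (simp_all add: maxwell_op_def Efld_def Hfld_def)

lemma maxwell_op_in_L2:
  assumes "u \<in> maxwell_dom a b j"
  shows "maxwell_op (box a b) j u \<in> L2 (box a b)"
  using L2_Pair[OF maxwell_domD(3)[OF assms] L2_scaleR[OF maxwell_domD(2)[OF assms], of "-1"]]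
  by (simp add: maxwell_op_def)

lemma has_curl_zero: "has_curl D j (\<lambda>x. 0) (\<lambda>x. 0)"
proof -
  have "curl_coeff j 0 = 0"
    by (simp add: curl_coeff_def vec_eq_iff forall_3)
  then show ?thesis by (simp add: has_curl_def has_weak_partial_def L2_zero)
qed

text \<open>The domain conditions on the two components are independent of each other, and the zero
  magnetic field has curl zero. Splitting off one component isolates one term of the skew-symmetry
  identity.\<close>

lemma maxwell_dom_electric_part:
  assumes "u \<in> maxwell_dom a b j"
  shows "(\<lambda>x. (Efld u x, 0)) \<in> maxwell_dom a b j"
  using assms L2_Pair[OF L2_fields(1)[OF maxwell_domD(1)[OF assms]] L2_zero]
  by (auto simp: maxwell_dom_def Efld_def Hfld_def intro: has_curl_zero)

lemma maxwell_dom_magnetic_part: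
  assumes "u \<in> maxwell_dom a b j"
  shows "(\<lambda>x. (0, Hfld u x)) \<in> maxwell_dom a b j"
proof -
  have "vanishes_on_faces a b j (\<lambda>x. 0)"
    unfolding vanishes_on_faces_def by (rule exI[of _ "\<lambda>x. 0"]) (simp add: L2_eq_def)
  then show ?thesis
    using assms L2_Pair[OF L2_zero L2_fields(2)[OF maxwell_domD(1)[OF assms]]]
    by (auto simp: maxwell_dom_def Efld_def Hfld_def intro: has_curl_zero)
qed

text \<open>Skew-symmetry is applied to the electric part of \<open>u\<close> and the magnetic part
  of \<open>v\<close>. Its minus sign cancels the one in the second component of
  \<open>maxwell_op\<close>, and the curls of the zero fields are paired only with zero.\<close>

lemma curl_symmetric:
  assumes sg: "C0_semigroup (box a b) S" "unitary_semigroup (box a b) S"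
    "is_generator (box a b) S (maxwell_dom a b j) (maxwell_op (box a b) j)"
    and u: "u \<in> maxwell_dom a b j" and v: "v \<in> maxwell_dom a b j"
  shows "L2_inner (box a b) (Efld u) (curl (box a b) j (Hfld v))
    = L2_inner (box a b) (curl (box a b) j (Efld u)) (Hfld v)"
proof -
  let ?u = "\<lambda>x. (Efld u x, 0)" and ?v = "\<lambda>x. (0, Hfld v x)"
  have u': "?u \<in> maxwell_dom a b j" and v': "?v \<in> maxwell_dom a b j"
    using u v maxwell_dom_electric_part maxwell_dom_magnetic_part by auto
  have "L2_inner (box a b) ?u (maxwell_op (box a b) j ?v)
      = - L2_inner (box a b) (maxwell_op (box a b) j ?u) ?v"
    by (intro generator_skew_symmetric[OF sg] u' v' maxwell_domD(1)[OF u'] maxwell_domD(1)[OF v']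
        maxwell_op_in_L2)
  moreover have "Efld ?u = Efld u" "Hfld ?v = Hfld v" by (auto simp: Efld_def Hfld_def)
  ultimately show ?thesis
    by (simp add: L2_inner_def maxwell_op_def inner_prod_def)
qed

section \<open>The derivative of the phase flow in the initial value\<close>

text \<open>The term \<open>Y t \<omega>\<close> cancels in the difference, and the quotient equals
  \<open>S t \<zeta>\<close> almost everywhere for each nonzero \<epsilon>. The limit is thus that
  of a constant, which is zero exactly under almost everywhere equality.\<close>

lemma has_dir_deriv_phase_flow_iff:
  assumes op: "L2_operator D (S t)" and z: "z \<in> L2 D" and \<zeta>: "\<zeta> \<in> L2 D"
  shows "has_dir_deriv D (phase_flow S Y t \<omega>) z \<zeta> \<xi> \<longleftrightarrow> \<xi> \<in> L2 D \<and> L2_eq D (S t \<zeta>) \<xi>"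
proof (cases "\<xi> \<in> L2 D")
  case \<xi>: True
  let ?F = "phase_flow S Y t \<omega>"
  let ?n = "\<lambda>\<epsilon>. L2_norm D (\<lambda>x. (1/\<epsilon>) *\<^sub>R (?F (\<lambda>y. z y + \<epsilon> *\<^sub>R \<zeta> y) x - ?F z x) - \<xi> x)"
  note cl = L2_operator_closed[OF op]
  have "?n \<epsilon> = L2_norm D (\<lambda>x. S t \<zeta> x - \<xi> x)" if "\<epsilon> \<noteq> 0" for \<epsilon>
  proof -
    have "?n \<epsilon> = L2_norm D (\<lambda>x. (1/\<epsilon>) *\<^sub>R (S t (\<lambda>y. z y + \<epsilon> *\<^sub>R \<zeta> y) x - S t z x) - \<xi> x)"
      by (simp add: phase_flow_def)
    also have "\<dots> = L2_norm D (\<lambda>x. S t \<zeta> x - \<xi> x)"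
    proof (rule L2_norm_cong)
      show "L2_eq D (\<lambda>x. (1/\<epsilon>) *\<^sub>R (S t (\<lambda>y. z y + \<epsilon> *\<^sub>R \<zeta> y) x - S t z x) - \<xi> x)
          (\<lambda>x. S t \<zeta> x - \<xi> x)"
        using L2_operator_add_scaleR[OF op z \<zeta>, of \<epsilon>] that
        unfolding L2_eq_def by (auto elim!: eventually_mono)
    qed (intro L2_diff L2_scaleR L2_add cl z \<zeta> \<xi>)+
    finally show ?thesis .
  qed
  then have "(?n \<longlongrightarrow> 0) (at 0) \<longleftrightarrow> ((\<lambda>\<epsilon>::real. L2_norm D (\<lambda>x. S t \<zeta> x - \<xi> x)) \<longlongrightarrow> 0) (at 0)"
    by (intro tendsto_cong) (auto simp: eventually_at_filter)
  also have "\<dots> \<longleftrightarrow> L2_eq D (S t \<zeta>) \<xi>"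
    by (simp add: tendsto_const_iff L2_norm_diff_eq_0_iff cl \<zeta> \<xi>)
  finally show ?thesis using \<xi> by (simp add: has_dir_deriv_def)
qed (simp add: has_dir_deriv_def)

lemma dir_deriv_phase_flow:
  assumes "L2_operator D (S t)" and "z \<in> L2 D" and "\<zeta> \<in> L2 D"
  shows "dir_deriv D (phase_flow S Y t \<omega>) z \<zeta> \<in> L2 D"
    and "L2_eq D (S t \<zeta>) (dir_deriv D (phase_flow S Y t \<omega>) z \<zeta>)"
proof -
  have "has_dir_deriv D (phase_flow S Y t \<omega>) z \<zeta> (dir_deriv D (phase_flow S Y t \<omega>) z \<zeta>)"
    unfolding dir_deriv_def
    by (rule someI[of _ "S t \<zeta>"])
      (simp add: has_dir_deriv_phase_flow_iff[where S = S and t = t, OF assms] L2_operator_closed[OF assms(1)] assms L2_eq_refl)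
  then show "dir_deriv D (phase_flow S Y t \<omega>) z \<zeta> \<in> L2 D"
    and "L2_eq D (S t \<zeta>) (dir_deriv D (phase_flow S Y t \<omega>) z \<zeta>)"
    by (auto simp: has_dir_deriv_phase_flow_iff[where S = S and t = t, OF assms])
qed

section \<open>Conservation of the two-form\<close>

text \<open>The right-hand side contains neither t nor \<omega>, so conservation follows by
  comparing time t with time 0.\<close>

lemma symplectic_form_phase_flow:
  assumes sg: "C0_semigroup (box a b) S" "unitary_semigroup (box a b) S"
    "is_generator (box a b) S (maxwell_dom a b j) (maxwell_op (box a b) j)"
    and t: "t \<ge> 0" and z: "z \<in> L2 (box a b)"
    and \<xi>: "\<xi> \<in> maxwell_dom a b j" and \<eta>: "\<eta> \<in> maxwell_dom a b j"
  shows "symplectic_form (box a b) j (phase_flow S Y t \<omega>) z \<xi> \<eta>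
    = L2_inner (box a b) \<xi> (maxwell_op (box a b) j \<eta>)"
proof -
  let ?D = "box a b"
  let ?F = "phase_flow S Y t \<omega>" and ?M = "maxwell_op ?D j"
  have op: "L2_operator ?D (S t)" using sg(1) t by (auto simp: C0_semigroup_def)
  note cl = L2_operator_closed[OF op]
  note dom = maxwell_domD
  have \<xi>t: "S t \<xi> \<in> maxwell_dom a b j" and \<eta>t: "S t \<eta> \<in> maxwell_dom a b j"
    and comm: "L2_eq ?D (S t (?M \<eta>)) (?M (S t \<eta>))"
    using generator_commute[OF sg \<xi> dom(1)[OF \<xi>] maxwell_op_in_L2[OF \<xi>] t]
      generator_commute[OF sg \<eta> dom(1)[OF \<eta>] maxwell_op_in_L2[OF \<eta>] t] by simp_all
  note dd = dir_deriv_phase_flow[where S = S and t = t and Y = Y and \<omega> = \<omega>, OF op z]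
  \<comment> \<open>The representative chosen by \<open>dir_deriv\<close> agrees with
    \<open>S t \<zeta>\<close> only almost everywhere. For the electric field this suffices under
    the integral; for the curl, \<open>curl_cong\<close> gives equality of functions.\<close>
  have E: "Efld (dir_deriv ?D ?F z \<zeta>) \<in> L2 ?D"
    "L2_eq ?D (Efld (dir_deriv ?D ?F z \<zeta>)) (Efld (S t \<zeta>))"
    and H: "curl ?D j (Hfld (dir_deriv ?D ?F z \<zeta>)) = curl ?D j (Hfld (S t \<zeta>))"
    if "\<zeta> \<in> maxwell_dom a b j" for \<zeta>
  proof -
    note \<zeta> = dom(1)[OF that]
    note eq = L2_eq_sym[OF dd(2)[OF \<zeta>]]
    show "Efld (dir_deriv ?D ?F z \<zeta>) \<in> L2 ?D" by (rule L2_fields(1)[OF dd(1)[OF \<zeta>]])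
    show "L2_eq ?D (Efld (dir_deriv ?D ?F z \<zeta>)) (Efld (S t \<zeta>))" by (rule L2_eq_fields(1)[OF eq])
    show "curl ?D j (Hfld (dir_deriv ?D ?F z \<zeta>)) = curl ?D j (Hfld (S t \<zeta>))"
      by (rule curl_cong[OF L2_eq_fields(2)[OF eq] L2_fields(2)[OF dd(1)[OF \<zeta>]] L2_fields(2)[OF cl[OF \<zeta>]]])
  qed
  have "symplectic_form ?D j ?F z \<xi> \<eta>
      = (\<integral>x. Efld (dir_deriv ?D ?F z \<xi>) x \<bullet> curl ?D j (Hfld (S t \<eta>)) x
          - Efld (dir_deriv ?D ?F z \<eta>) x \<bullet> curl ?D j (Hfld (S t \<xi>)) x \<partial>lebesgue_on ?D)"
    by (simp add: symplectic_form_def wedge_def H \<xi> \<eta> sum_subtractf inner_vec_def)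
  also have "\<dots> = L2_inner ?D (Efld (dir_deriv ?D ?F z \<xi>)) (curl ?D j (Hfld (S t \<eta>)))
      - L2_inner ?D (Efld (dir_deriv ?D ?F z \<eta>)) (curl ?D j (Hfld (S t \<xi>)))"
    by (simp add: L2_inner_def L2_integrable_inner E \<xi> \<eta> dom(3)[OF \<xi>t] dom(3)[OF \<eta>t])
  also have "\<dots> = L2_inner ?D (Efld (S t \<xi>)) (curl ?D j (Hfld (S t \<eta>)))
      - L2_inner ?D (Efld (S t \<eta>)) (curl ?D j (Hfld (S t \<xi>)))"
    by (intro arg_cong2[where f = "(-)"] L2_inner_cong E \<xi> \<eta> L2_fields dom(1)[OF \<xi>t] dom(1)[OF \<eta>t]
        dom(3)[OF \<xi>t] dom(3)[OF \<eta>t] L2_eq_refl)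
  \<comment> \<open>Moving the curl onto the electric part of \<open>S t \<eta>\<close> makes the
    two terms the components of one pairing of \<open>S t \<xi>\<close> with
    \<open>?M (S t \<eta>)\<close>.\<close>
  also have "\<dots> = L2_inner ?D (Efld (S t \<xi>)) (curl ?D j (Hfld (S t \<eta>)))
      - L2_inner ?D (Hfld (S t \<xi>)) (curl ?D j (Efld (S t \<eta>)))"
    by (simp only: curl_symmetric[OF sg \<eta>t \<xi>t] L2_inner_commute[of ?D "Hfld (S t \<xi>)"])
  also have "\<dots> = L2_inner ?D (S t \<xi>) (?M (S t \<eta>))"
    using L2_inner_em_field[OF dom(1)[OF \<xi>t] maxwell_op_in_L2[OF \<eta>t]]
    by (simp add: maxwell_op_fields L2_inner_def)
  also have "\<dots> = L2_inner ?D (S t \<xi>) (S t (?M \<eta>))"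
    by (intro L2_inner_cong L2_eq_refl L2_eq_sym[OF comm] cl dom(1)[OF \<xi>] dom(1)[OF \<xi>t]
        maxwell_op_in_L2 \<eta> \<eta>t)
  also have "\<dots> = L2_inner ?D \<xi> (?M \<eta>)"
    using sg(2) t
    by (intro L2_isometry_inner[OF op] dom(1)[OF \<xi>] maxwell_op_in_L2 \<eta>) (auto simp: unitary_semigroup_def)
  finally show ?thesis .
qed

text \<open>The existence clause ensures that \<open>dir_deriv\<close> denotes a genuine derivative
  with a representative in the domain, where the curls are square integrable; the conserved quantity
  is therefore not built from an arbitrary value of \<open>SOME\<close>.\<close>

theorem lemma3p2:
  fixes a b lam1 lam2 :: "real^3" and D :: "(real^3) set" and j :: 3
    and P :: "'w measure" and Q :: "(real^3 \<Rightarrow> real) \<Rightarrow> (real^3 \<Rightarrow> real)"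
    and W :: "real \<Rightarrow> 'w \<Rightarrow> real^3 \<Rightarrow> real"
    and S :: "real \<Rightarrow> em_field \<Rightarrow> em_field" and Y :: "real \<Rightarrow> 'w \<Rightarrow> em_field"
  assumes cuboid: "\<And>i. a$i < b$i" "D = box a b"
    and cov: "covariance_operator D Q"
    and wiener: "wiener_process P D Q W"
    and semigroup: "C0_semigroup D S" "unitary_semigroup D S"
    and generator: "is_generator D S (maxwell_dom a b j) (maxwell_op D j)"
    and convolution: "stochastic_convolution P D Q W S (noise_mult j lam1 lam2) Y"
  shows "AE \<omega> in P. \<forall>t\<ge>0. \<forall>z\<in>L2 D.
           (\<forall>\<zeta>\<in>maxwell_dom a b j. \<exists>\<xi>\<in>maxwell_dom a b j. has_dir_deriv D (phase_flow S Y t \<omega>) z \<zeta> \<xi>) \<and>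
           (\<forall>\<xi>0\<in>maxwell_dom a b j. \<forall>\<eta>0\<in>maxwell_dom a b j.
              symplectic_form D j (phase_flow S Y t \<omega>) z \<xi>0 \<eta>0 =
              symplectic_form D j (phase_flow S Y 0 \<omega>) z \<xi>0 \<eta>0)"
proof (rule AE_I2, intro allI ballI impI conjI)
  fix \<omega> and t :: real and z :: em_field
  assume t: "0 \<le> t" and z: "z \<in> L2 D"
  note sg = semigroup[unfolded cuboid(2)] generator[unfolded cuboid(2)]
  have op: "L2_operator D (S t)" using semigroup(1) t by (auto simp: C0_semigroup_def)
  show "\<exists>\<xi>\<in>maxwell_dom a b j. has_dir_deriv D (phase_flow S Y t \<omega>) z \<zeta> \<xi>"
    if \<zeta>: "\<zeta> \<in> maxwell_dom a b j" for \<zeta>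
  proof
    have \<zeta>': "\<zeta> \<in> L2 D" using maxwell_domD(1)[OF \<zeta>] cuboid(2) by simp
    show "S t \<zeta> \<in> maxwell_dom a b j"
      using generator_commute(1)[OF sg \<zeta> maxwell_domD(1)[OF \<zeta>] maxwell_op_in_L2[OF \<zeta>] t] .
    show "has_dir_deriv D (phase_flow S Y t \<omega>) z \<zeta> (S t \<zeta>)"
      by (simp add: has_dir_deriv_phase_flow_iff[where S = S and t = t, OF op z \<zeta>'] L2_operator_closed[OF op \<zeta>'] L2_eq_refl)
  qed
  show "symplectic_form D j (phase_flow S Y t \<omega>) z \<xi>0 \<eta>0
      = symplectic_form D j (phase_flow S Y 0 \<omega>) z \<xi>0 \<eta>0"
    if "\<xi>0 \<in> maxwell_dom a b j" "\<eta>0 \<in> maxwell_dom a b j" for \<xi>0 \<eta>0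
    using symplectic_form_phase_flow[where Y = Y and \<omega> = \<omega>, OF sg _ _ that, of t z]
      symplectic_form_phase_flow[where Y = Y and \<omega> = \<omega>, OF sg _ _ that, of 0 z] t z
    unfolding cuboid(2) by simp
qed

end
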